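(* Let $0\le k\le n$ and let $\mathsf{N}_1,\dots,\mathsf{N}_s$ be a set of representatives of the isomorphism classes of cuspidal matroids of rank $k$ on $n$ elements. Then for every matroid $\mathsf{M}$ of rank $k$ on $n$ elements there exist unique integers $c_1,\dots,c_s$ such that $T_{\mathsf{M}}(x,y)=\sum_{i=1}^s c_i\,T_{\mathsf{N}_i}(x,y)$.
   Context: $T_{\mathsf{M}}(x,y)$ is the Tutte polynomial. $\mathsf{U}_{r,m}$ is the uniform matroid of rank $r$ on $m$ elements. A matroid is elementary split if it has no minor isomorphic to $\mathsf{U}_{0,1}\oplus\mathsf{U}_{1,2}\oplus\mathsf{U}_{1,1}$; it is Schubert (nested) if its lattice of cyclic flats is a chain; it is cuspidal if it is both Schubert and elementary split. *)

theory Defs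
  imports "HOL-Computational_Algebra.Polynomial"
begin

record 'a matroid =
  ground :: "'a set"
  indep :: "'a set set"

definition is_matroid :: "'a matroid \<Rightarrow> bool" where
  "is_matroid M \<longleftrightarrow> finite (ground M)
     \<and> (\<forall>X\<in>indep M. X \<subseteq> ground M)
     \<and> {} \<in> indep M
     \<and> (\<forall>X Y. X \<in> indep M \<longrightarrow> Y \<subseteq> X \<longrightarrow> Y \<in> indep M)
     \<and> (\<forall>X Y. X \<in> indep M \<longrightarrow> Y \<in> indep M \<longrightarrow> card X < card Y
            \<longrightarrow> (\<exists>e\<in>Y - X. insert e X \<in> indep M))"

definition mrank :: "'a matroid \<Rightarrow> 'a set \<Rightarrow> nat" where
  "mrank M A = Max (card ` {X. X \<subseteq> A \<and> X \<in> indep M})"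

definition matroid_rank :: "'a matroid \<Rightarrow> nat" where
  "matroid_rank M = mrank M (ground M)"

definition mdelete :: "'a matroid \<Rightarrow> 'a set \<Rightarrow> 'a matroid" where
  "mdelete M D = \<lparr>ground = ground M - D, indep = {X \<in> indep M. X \<inter> D = {}}\<rparr>"

definition mcontract :: "'a matroid \<Rightarrow> 'a set \<Rightarrow> 'a matroid" where
  "mcontract M C = \<lparr>ground = ground M - C,
     indep = {X. X \<subseteq> ground M - C \<and> mrank M (X \<union> C) = card X + mrank M C}\<rparr>"

definition is_minor :: "'a matroid \<Rightarrow> 'a matroid \<Rightarrow> bool" where
  "is_minor N M \<longleftrightarrow> (\<exists>C D. C \<subseteq> ground M \<and> D \<subseteq> ground M \<and> C \<inter> D = {}
      \<and> N = mdelete (mcontract M C) D)"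

definition matroid_iso :: "'a matroid \<Rightarrow> 'b matroid \<Rightarrow> bool" where
  "matroid_iso M N \<longleftrightarrow> (\<exists>f. bij_betw f (ground M) (ground N)
      \<and> (\<forall>X. X \<subseteq> ground M \<longrightarrow> (X \<in> indep M \<longleftrightarrow> f ` X \<in> indep N)))"

text \<open>The matroid U_{0,1} (+) U_{1,2} (+) U_{1,1} on {0,1,2,3}: 0 is a loop,
  1,2 are parallel, 3 is a coloop.\<close>
definition U01_U12_U11 :: "nat matroid" where
  "U01_U12_U11 = \<lparr>ground = {0,1,2,3},
     indep = {X. X \<subseteq> {1,2,3} \<and> card (X \<inter> {1,2}) \<le> 1}\<rparr>"

definition elementary_split :: "'a matroid \<Rightarrow> bool" where
  "elementary_split M \<longleftrightarrow> \<not> (\<exists>N. is_minor N M \<and> matroid_iso N U01_U12_U11)"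

definition circuit :: "'a matroid \<Rightarrow> 'a set \<Rightarrow> bool" where
  "circuit M C \<longleftrightarrow> C \<subseteq> ground M \<and> C \<notin> indep M \<and> (\<forall>Y. Y \<subset> C \<longrightarrow> Y \<in> indep M)"

definition flat :: "'a matroid \<Rightarrow> 'a set \<Rightarrow> bool" where
  "flat M F \<longleftrightarrow> F \<subseteq> ground M \<and> (\<forall>e \<in> ground M - F. mrank M (insert e F) > mrank M F)"

definition cyclic :: "'a matroid \<Rightarrow> 'a set \<Rightarrow> bool" where
  "cyclic M X \<longleftrightarrow> X = \<Union>{C. circuit M C \<and> C \<subseteq> X}"

definition cyclic_flat :: "'a matroid \<Rightarrow> 'a set \<Rightarrow> bool" where
  "cyclic_flat M F \<longleftrightarrow> flat M F \<and> cyclic M F"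

definition schubert :: "'a matroid \<Rightarrow> bool" where
  "schubert M \<longleftrightarrow> (\<forall>F G. cyclic_flat M F \<longrightarrow> cyclic_flat M G \<longrightarrow> F \<subseteq> G \<or> G \<subseteq> F)"

definition cuspidal :: "'a matroid \<Rightarrow> bool" where
  "cuspidal M \<longleftrightarrow> schubert M \<and> elementary_split M"

text \<open>Tutte polynomial as a bivariate integer polynomial: an element of int poly poly,
  where the inner variable is x and the outer variable is y.\<close>
definition tutte_x :: "int poly poly" where
  "tutte_x = [:[:0, 1:]:]"

definition tutte_y :: "int poly poly" where
  "tutte_y = [:0, 1:]"

definition tutte :: "'a matroid \<Rightarrow> int poly poly" where
  "tutte M = (\<Sum>A\<in>Pow (ground M).
      (tutte_x - 1) ^ (mrank M (ground M) - mrank M A) * (tutte_y - 1) ^ (card A - mrank M A))"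

end

theory Submission
  imports Defs
begin

text \<open>Write \<open>X = x - 1\<close>, \<open>Y = y - 1\<close>, and let \<open>w\<^sub>i\<^sub>j(M)\<close> be the number of subsets of corank \<open>i\<close> and
  nullity \<open>j\<close>. A set \<open>A\<close> contributes \<open>X\<^sup>i Y\<^sup>j\<close>, and \<open>j - i = |A| - k\<close>, so cancelling the common
  powers of \<open>X\<close> and \<open>Y\<close> leaves a term that depends only on \<open>|A|\<close>. Hence every Tutte polynomial of rank
  \<open>k\<close> on \<open>n\<close> elements is the one of \<open>U\<^sub>k\<^sub>,\<^sub>n\<close> plus a combination, with coefficients \<open>w\<^sub>i\<^sub>j\<close> for
  \<open>1 \<le> i \<le> k\<close> and \<open>1 \<le> j \<le> n - k\<close>, of linearly independent polynomials. A cuspidal matroid has at most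
  one cyclic flat \<open>F\<close> other than the empty set and the ground set; it is determined up to isomorphism by
  the corank \<open>a\<close> and the nullity \<open>b\<close> of \<open>F\<close>. Its \<open>w\<^sub>i\<^sub>j\<close> vanish unless \<open>i \<le> a\<close> and \<open>j \<le> b\<close>, and only \<open>F\<close>
  itself attains \<open>(a, b)\<close>, so the coordinate matrix of the cuspidal matroids is unitriangular
  over the integers.\<close>

section \<open>Rank, cyclic sets and cyclic flats\<close>

locale finite_matroid =
  fixes M :: "'a matroid"
  assumes is_matroid: "is_matroid M"
begin

abbreviation "E \<equiv> ground M"
abbreviation "rk \<equiv> mrank M"

section \<open>The rank function and extension to bases\<close>

lemma finite_ground [simp]: "finite E"
  using is_matroid by (simp add: is_matroid_def)

lemma indep_subset_ground: "X \<in> indep M \<Longrightarrow> X \<subseteq> E"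
  using is_matroid by (simp add: is_matroid_def)

lemma empty_indep [simp]: "{} \<in> indep M"
  using is_matroid by (simp add: is_matroid_def)

lemma indep_subset: "X \<in> indep M \<Longrightarrow> Y \<subseteq> X \<Longrightarrow> Y \<in> indep M"
  using is_matroid by (simp add: is_matroid_def)

lemma indep_augment:
  "X \<in> indep M \<Longrightarrow> Y \<in> indep M \<Longrightarrow> card X < card Y \<Longrightarrow> \<exists>e\<in>Y - X. insert e X \<in> indep M"
  using is_matroid by (simp add: is_matroid_def)

lemma indep_finite: "X \<in> indep M \<Longrightarrow> finite X"
  using indep_subset_ground finite_ground finite_subset by blast

lemma finite_indep_subsets: "finite {X. X \<subseteq> A \<and> X \<in> indep M}"
  by (rule finite_subset[of _ "Pow E"]) (auto dest: indep_subset_ground)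

lemma card_le_mrank: "X \<in> indep M \<Longrightarrow> X \<subseteq> A \<Longrightarrow> card X \<le> rk A"
  unfolding mrank_def by (rule Max_ge) (auto simp: finite_indep_subsets)

lemma ex_basis: "\<exists>B \<subseteq> A. B \<in> indep M \<and> card B = rk A"
proof -
  have "rk A \<in> card ` {X. X \<subseteq> A \<and> X \<in> indep M}"
    unfolding mrank_def
    by (rule Max_in) (use finite_indep_subsets empty_indep in blast)+
  then show ?thesis by auto
qed

lemma mrank_mono: "A \<subseteq> B \<Longrightarrow> rk A \<le> rk B"
  using ex_basis[of A] card_le_mrank[of _ B] by (metis order_trans)

lemma mrank_le_card: "finite A \<Longrightarrow> rk A \<le> card A"
  using ex_basis[of A] by (metis card_mono)

lemma mrank_indep: "X \<in> indep M \<Longrightarrow> rk X = card X"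
  using card_le_mrank[of X X] mrank_le_card[of X] indep_finite by force

lemma indep_iff_mrank: "X \<subseteq> E \<Longrightarrow> X \<in> indep M \<longleftrightarrow> rk X = card X"
  by (metis card_subset_eq ex_basis finite_ground finite_subset mrank_indep)

lemma ex_basis_extending:
  assumes "X \<in> indep M" "X \<subseteq> A"
  shows "\<exists>B. X \<subseteq> B \<and> B \<subseteq> A \<and> B \<in> indep M \<and> card B = rk A"
  using assms
proof (induction "rk A - card X" arbitrary: X)
  case 0
  then show ?case using card_le_mrank[of X A] by fastforce
next
  case (Suc m)
  obtain B where B: "B \<subseteq> A" "B \<in> indep M" "card B = rk A"
    using ex_basis by blast
  then obtain e where e: "e \<in> B - X" "insert e X \<in> indep M"
    using indep_augment[of X B] Suc by force
  have "card (insert e X) = Suc (card X)"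
    using e indep_finite[OF Suc.prems(1)] by simp
  then have "\<exists>B'. insert e X \<subseteq> B' \<and> B' \<subseteq> A \<and> B' \<in> indep M \<and> card B' = rk A"
    using Suc.hyps(2) Suc.prems e B by (intro Suc.hyps(1)) auto
  then show ?case by blast
qed

lemma mrank_insert_le: "rk (insert e A) \<le> Suc (rk A)"
proof -
  obtain B where B: "B \<subseteq> insert e A" "B \<in> indep M" "card B = rk (insert e A)"
    using ex_basis by blast
  have "card (B - {e}) \<le> rk A"
    by (rule card_le_mrank) (use B indep_subset in auto)
  then show ?thesis using B(3) indep_finite[OF B(2)]
    by (simp add: card_Diff_singleton_if split: if_splits)
qed

lemma mrank_Un_le: "finite B \<Longrightarrow> rk (A \<union> B) \<le> rk A + card B"
proof (induction B rule: finite_induct)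
  case (insert e B)
  then show ?case using mrank_insert_le[of e "A \<union> B"] by simp
qed simp

text \<open>The span grows with the set, a local form of submodularity. Take a basis
  \<open>A0\<close> of \<open>A\<close> inside a basis \<open>B0\<close> of \<open>B\<close>. If
  \<open>e\<close> raised the rank of \<open>B\<close>, augmenting \<open>B0\<close> could only add
  \<open>e\<close>, and then \<open>insert e A0\<close> would be independent and too large for
  \<open>insert e A\<close>.\<close>

lemma mrank_insert_eq_mono:
  assumes "rk (insert e A) = rk A" "A \<subseteq> B"
  shows "rk (insert e B) = rk B"
proof (rule ccontr)
  assume "rk (insert e B) \<noteq> rk B"
  then have lt: "rk B < rk (insert e B)"
    using mrank_mono[OF subset_insertI, of B e] by linarith
  obtain A0 where A0: "A0 \<subseteq> A" "A0 \<in> indep M" "card A0 = rk A"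
    using ex_basis by blast
  obtain B0 where B0: "A0 \<subseteq> B0" "B0 \<subseteq> B" "B0 \<in> indep M" "card B0 = rk B"
    using ex_basis_extending[of A0 B] A0 assms(2) by blast
  obtain B1 where B1: "B1 \<subseteq> insert e B" "B1 \<in> indep M" "card B1 = rk (insert e B)"
    using ex_basis by blast
  obtain x where x: "x \<in> B1 - B0" "insert x B0 \<in> indep M"
    using indep_augment[of B0 B1] B0 B1 lt by auto
  have card_x: "card (insert x B0) = Suc (rk B)"
    using x B0 indep_finite[OF B0(3)] by simp
  have "x \<notin> B"
    using card_le_mrank[OF x(2), of B] card_x B0(2) by auto
  then have xe: "x = e" using x B1 by blast
  have "insert e A0 \<in> indep M"
    using x(2) xe B0(1) indep_subset by blast
  then have "card (insert e A0) \<le> rk A"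
    using card_le_mrank[of "insert e A0" "insert e A"] A0(1) assms(1) by auto
  moreover have "e \<notin> A0" using x xe B0(1) by blast
  ultimately show False using A0 indep_finite[OF A0(2)] by simp
qed

text \<open>A basis of \<open>insert e A\<close> that extends \<open>X\<close> is larger than the
  rank of \<open>A\<close>, so it has to contain \<open>e\<close>.\<close>

lemma insert_basis_indep:
  assumes X: "X \<in> indep M" "X \<subseteq> A" and card_X: "card X = rk A"
    and lt: "rk A < rk (insert e A)"
  shows "insert e X \<in> indep M"
proof -
  obtain B where B: "X \<subseteq> B" "B \<subseteq> insert e A" "B \<in> indep M" "card B = rk (insert e A)"
    using ex_basis_extending[OF X(1) subset_insertI2[OF X(2)], of e] by blast
  have "e \<in> B"
  proof (rule ccontr)
    assume "e \<notin> B"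
    then have "B \<subseteq> A" using B(2) by blast
    then show False using card_le_mrank[OF B(3), of A] B(4) lt by simp
  qed
  then show ?thesis using B(1) indep_subset[OF B(3), of "insert e X"] by blast
qed

section \<open>Circuits, cyclic sets and cyclic flats\<close>

lemma dependent_ex_circuit:
  assumes "X \<subseteq> E" "X \<notin> indep M"
  shows "\<exists>C \<subseteq> X. circuit M C"
  using finite_subset[OF assms(1) finite_ground] assms
proof (induction X rule: finite_psubset_induct)
  case (psubset X)
  show ?case
  proof (cases "\<forall>Y. Y \<subset> X \<longrightarrow> Y \<in> indep M")
    case True
    then show ?thesis using psubset.prems unfolding circuit_def by blast
  next
    case False
    then obtain Y where "Y \<subset> X" "Y \<notin> indep M" by blast
    then show ?thesis using psubset.IH[of Y] psubset.prems by blast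
  qed
qed

text \<open>A circuit through \<open>z\<close> shows that the rest of \<open>Z\<close> spans
  \<open>z\<close>. Conversely, adding a spanned \<open>z\<close> to a basis of
  \<open>Z - {z}\<close> creates a circuit, and that circuit passes through \<open>z\<close>. Later
  arguments use only this rank condition, never circuits.\<close>

lemma cyclic_iff_mrank:
  assumes "Z \<subseteq> E"
  shows "cyclic M Z \<longleftrightarrow> (\<forall>z\<in>Z. rk (Z - {z}) = rk Z)"
proof
  assume cyc: "cyclic M Z"
  show "\<forall>z\<in>Z. rk (Z - {z}) = rk Z"
  proof
    fix z assume z: "z \<in> Z"
    then obtain C where C: "circuit M C" "C \<subseteq> Z" "z \<in> C"
      using cyc unfolding cyclic_def by blast
    have ind: "C - {z} \<in> indep M" using C unfolding circuit_def by blast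
    have dep: "C \<notin> indep M" using C unfolding circuit_def by blast
    have "rk C = rk (C - {z})"
    proof (rule antisym)
      have fC: "finite C"
        using C(1) unfolding circuit_def by (meson finite_ground finite_subset)
      have "rk C \<le> card C" "rk C \<noteq> card C"
        using mrank_le_card[OF fC] indep_iff_mrank[of C] C(1) dep
        unfolding circuit_def by auto
      then show "rk C \<le> rk (C - {z})"
        using mrank_indep[OF ind] fC C(3) by simp
    qed (rule mrank_mono, blast)
    then have "rk (insert z (C - {z})) = rk (C - {z})"
      using C(3) by (simp add: insert_absorb)
    from mrank_insert_eq_mono[OF this, of "Z - {z}"]
    show "rk (Z - {z}) = rk Z" using C z by (simp add: insert_absorb Diff_mono)
  qed
next
  assume r: "\<forall>z\<in>Z. rk (Z - {z}) = rk Z"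
  have "\<exists>C. circuit M C \<and> C \<subseteq> Z \<and> z \<in> C" if z: "z \<in> Z" for z
  proof -
    obtain B where B: "B \<subseteq> Z - {z}" "B \<in> indep M" "card B = rk (Z - {z})"
      using ex_basis by blast
    have "insert z B \<notin> indep M"
    proof
      assume "insert z B \<in> indep M"
      then have "card (insert z B) \<le> rk Z"
        using card_le_mrank[of "insert z B" Z] B(1) z by blast
      moreover have "card (insert z B) = Suc (card B)"
        using B indep_finite[OF B(2)] by (subst card_insert_disjoint) auto
      ultimately show False using B(3) r z by simp
    qed
    then obtain C where C: "C \<subseteq> insert z B" "circuit M C"
      using dependent_ex_circuit[of "insert z B"] B assms z by blast
    have "z \<in> C"
      using C indep_subset[OF B(2), of C] unfolding circuit_def by blast
    then show ?thesis using C B z by blast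
  qed
  then show "cyclic M Z" unfolding cyclic_def by blast
qed

text \<open>A circuit spans a cyclic flat, so independence is decided by the cyclic flats.\<close>
lemma dependent_ex_cyclic_flat:
  assumes "X \<subseteq> E" "X \<notin> indep M"
  shows "\<exists>Z. cyclic_flat M Z \<and> Z \<noteq> {} \<and> rk Z < card (X \<inter> Z)"
proof -
  obtain C where C: "C \<subseteq> X" "circuit M C"
    using dependent_ex_circuit assms by blast
  then have CE: "C \<subseteq> E" and dep: "C \<notin> indep M" and sub: "\<And>Y. Y \<subset> C \<Longrightarrow> Y \<in> indep M"
    unfolding circuit_def by auto
  have fC: "finite C" using CE finite_ground finite_subset by blast
  have "C \<noteq> {}" using dep by auto
  have rkC: "rk C < card C"
    using mrank_le_card[OF fC] indep_iff_mrank[OF CE] dep by auto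
  \<comment> \<open>The closure of the circuit \<open>C\<close>: it has the rank of
    \<open>C\<close>, and it turns out to be the required cyclic flat.\<close>
  define Z where "Z = {e \<in> E. rk (insert e C) = rk C}"
  have CZ: "C \<subseteq> Z" using CE by (auto simp: Z_def insert_absorb)
  have ZE: "Z \<subseteq> E" by (auto simp: Z_def)
  have fZ: "finite Z" using ZE finite_ground finite_subset by blast
  have "rk (C \<union> A) = rk C" if "finite A" "A \<subseteq> Z" for A
    using that
  proof (induction A rule: finite_induct)
    case (insert e A)
    then have "rk (insert e C) = rk C" by (auto simp: Z_def)
    from mrank_insert_eq_mono[OF this, of "C \<union> A"] insert show ?case by simp
  qed simp
  from this[OF fZ order_refl] have rkZ: "rk Z = rk C" using CZ by (simp add: Un_absorb1)
  have "flat M Z"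
    unfolding flat_def
  proof (intro conjI ballI ZE)
    fix e assume e: "e \<in> E - Z"
    then have "rk (insert e C) \<noteq> rk C" by (auto simp: Z_def)
    then have "rk C < rk (insert e C)"
      using mrank_mono[OF subset_insertI, of C e] by linarith
    also have "\<dots> \<le> rk (insert e Z)" using CZ by (intro mrank_mono) auto
    finally show "rk Z < rk (insert e Z)" using rkZ by simp
  qed
  moreover have "cyclic M Z"
    unfolding cyclic_iff_mrank[OF ZE]
  proof
    fix z assume z: "z \<in> Z"
    \<comment> \<open>Removing one element from a circuit leaves an independent set of the same
      rank, so \<open>Z - {z}\<close> still spans whether or not \<open>z\<close> lies on
      \<open>C\<close>.\<close>
    have "rk C \<le> rk (Z - {z})"
    proof (cases "z \<in> C")
      case True
      then have "rk (C - {z}) = card C - 1"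
        using mrank_indep[OF sub[of "C - {z}"]] fC by auto
      then have "rk C \<le> rk (C - {z})" using rkC by simp
      also have "\<dots> \<le> rk (Z - {z})" using CZ by (intro mrank_mono) auto
      finally show ?thesis .
    next
      case False
      then show ?thesis using CZ by (intro mrank_mono) auto
    qed
    then show "rk (Z - {z}) = rk Z"
      using rkZ mrank_mono[of "Z - {z}" Z] by auto
  qed
  moreover have "card C \<le> card (X \<inter> Z)"
    using C CZ fZ by (intro card_mono) auto
  then have "rk Z < card (X \<inter> Z)" using rkC rkZ by simp
  moreover have "Z \<noteq> {}" using CZ \<open>C \<noteq> {}\<close> by blast
  ultimately show ?thesis unfolding cyclic_flat_def by blast
qed

end

section \<open>Coordinates of Tutte polynomials\<close>

text \<open>Elimination in layers of the weight \<open>f\<close>, which replaces a linear order on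
  the indices. The induction is on a bound for \<open>f\<close> on the support of
  \<open>v\<close>.\<close>

lemma unitriangular_solvable:
  fixes W :: "'i \<Rightarrow> 'i \<Rightarrow> int" and f :: "'i \<Rightarrow> nat"
  assumes "finite I"
    and diag: "\<And>p. p \<in> I \<Longrightarrow> W p p = 1"
    and tri: "\<And>p q. p \<in> I \<Longrightarrow> q \<in> I \<Longrightarrow> W p q \<noteq> 0 \<Longrightarrow> q = p \<or> f q < f p"
  shows "\<exists>c. \<forall>q\<in>I. v q = (\<Sum>p\<in>I. c p * W p q)"
proof -
  have "\<exists>c. \<forall>q\<in>I. v q = (\<Sum>p\<in>I. c p * W p q)"
    if "\<forall>q\<in>I. N \<le> f q \<longrightarrow> v q = 0" for N v
    using that
  proof (induction N arbitrary: v)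
    case 0
    then show ?case by (intro exI[of _ "\<lambda>_. 0"]) simp
  next
    case (Suc N)
    \<comment> \<open>The top layer of \<open>v\<close> serves as its own coefficients: diagonal
      entries are 1, and the rows used reach other indices only at smaller weight. Subtracting them
      leaves a vector supported below weight \<open>N\<close>.\<close>
    define c0 where "c0 p = (if f p = N then v p else 0)" for p
    define v' where "v' q = v q - (\<Sum>p\<in>I. c0 p * W p q)" for q
    have "v' q = 0" if q: "q \<in> I" "N \<le> f q" for q
    proof -
      have "(\<Sum>p\<in>I. c0 p * W p q) = (\<Sum>p\<in>I. if p = q then c0 q else 0)"
      proof (rule sum.cong[OF refl])
        fix p assume p: "p \<in> I"
        then show "c0 p * W p q = (if p = q then c0 q else 0)"
          using tri[OF p q(1)] diag[OF q(1)] q(2) by (auto simp: c0_def)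
      qed
      also have "\<dots> = c0 q" using q \<open>finite I\<close> by simp
      finally show ?thesis using Suc.prems q by (auto simp: v'_def c0_def)
    qed
    then obtain c where c: "\<forall>q\<in>I. v' q = (\<Sum>p\<in>I. c p * W p q)"
      using Suc.IH[of v'] by blast
    show ?case
    proof (intro exI[of _ "\<lambda>p. c0 p + c p"] ballI)
      fix q assume "q \<in> I"
      then show "v q = (\<Sum>p\<in>I. (c0 p + c p) * W p q)"
        using c by (auto simp: v'_def distrib_right sum.distrib algebra_simps)
    qed
  qed
  moreover have "\<forall>q\<in>I. Suc (Max (f ` I)) \<le> f q \<longrightarrow> v q = 0"
    using Max_ge[of "f ` I"] \<open>finite I\<close> by (meson finite_imageI imageI not_less_eq_eq)
  ultimately show ?thesis by blast
qed

text \<open>Among the indices with nonzero coefficient take \<open>m\<close> of maximal weight. Only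
  row \<open>m\<close> contributes to column \<open>m\<close>, so that column sum is
  \<open>c m\<close>, which is not zero.\<close>

lemma unitriangular_injective:
  fixes W :: "'i \<Rightarrow> 'i \<Rightarrow> int" and f :: "'i \<Rightarrow> nat"
  assumes "finite I"
    and diag: "\<And>p. p \<in> I \<Longrightarrow> W p p = 1"
    and tri: "\<And>p q. p \<in> I \<Longrightarrow> q \<in> I \<Longrightarrow> W p q \<noteq> 0 \<Longrightarrow> q = p \<or> f q < f p"
    and zero: "\<And>q. q \<in> I \<Longrightarrow> (\<Sum>p\<in>I. c p * W p q) = 0"
    and "p \<in> I"
  shows "c p = 0"
proof (rule ccontr)
  assume "c p \<noteq> 0"
  define J where "J = {p \<in> I. c p \<noteq> 0}"
  have fJ: "finite (f ` J)" "f ` J \<noteq> {}"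
    using \<open>finite I\<close> \<open>p \<in> I\<close> \<open>c p \<noteq> 0\<close> by (auto simp: J_def)
  then obtain m where m: "m \<in> J" "f m = Max (f ` J)"
    using Max_in by (metis imageE)
  have max: "f p \<le> f m" if "p \<in> J" for p using that fJ m by simp
  have mI: "m \<in> I" using m by (simp add: J_def)
  have "(\<Sum>p\<in>I. c p * W p m) = (\<Sum>p\<in>I. if p = m then c m else 0)"
  proof (rule sum.cong[OF refl])
    fix p assume p: "p \<in> I"
    then show "c p * W p m = (if p = m then c m else 0)"
      using tri[OF p mI] diag[OF mI] max[of p] by (force simp: J_def)
  qed
  also have "\<dots> = c m" using mI \<open>finite I\<close> by simp
  finally show False using zero[OF mI] m by (simp add: J_def)
qed

text \<open>The coefficient of \<open>X^i Y^j\<close> after substituting \<open>x = X + 1\<close>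
  and \<open>y = Y + 1\<close>. The outer variable is \<open>y\<close>, so it is shifted and read
  off first.\<close>

definition shifted_coeff :: "nat \<Rightarrow> nat \<Rightarrow> int poly poly \<Rightarrow> int" where
  "shifted_coeff i j p = coeff (pcompose (coeff (pcompose p [:1, 1:]) j) [:1, 1:]) i"

abbreviation corank_nullity_monom :: "nat \<Rightarrow> nat \<Rightarrow> int poly poly" where
  "corank_nullity_monom i j \<equiv> (tutte_x - 1) ^ i * (tutte_y - 1) ^ j"

lemma shifted_coeff_add: "shifted_coeff i j (p + q) = shifted_coeff i j p + shifted_coeff i j q"
  by (simp add: shifted_coeff_def pcompose_add)

lemma shifted_coeff_diff: "shifted_coeff i j (p - q) = shifted_coeff i j p - shifted_coeff i j q"
  by (simp add: shifted_coeff_def pcompose_diff)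

lemma shifted_coeff_0: "shifted_coeff i j 0 = 0"
  by (simp add: shifted_coeff_def)

lemma shifted_coeff_sum: "shifted_coeff i j (\<Sum>a\<in>A. g a) = (\<Sum>a\<in>A. shifted_coeff i j (g a))"
  by (induction A rule: infinite_finite_induct) (auto simp: shifted_coeff_0 shifted_coeff_add)

lemma shifted_coeff_of_int_mult: "shifted_coeff i j (of_int c * p) = c * shifted_coeff i j p"
proof -
  have "of_int c * p = smult [:c:] p"
    by (simp add: of_int_poly)
  then show ?thesis
    by (simp add: shifted_coeff_def pcompose_smult)
qed

lemma shifted_coeff_monom:
  "shifted_coeff i j (corank_nullity_monom a b) = (if i = a \<and> j = b then 1 else 0)"
proof -
  have x: "(tutte_x - 1) ^ a = [:[:-1, 1:] ^ a:]"
    by (induction a) (auto simp: tutte_x_def one_pCons)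
  have y: "pcompose ((tutte_y - 1) ^ b) [:1, 1:] = monom 1 b"
  proof (induction b)
    case (Suc b)
    have "pcompose (tutte_y - 1) [:1, 1:] = [:0, 1:]"
      by (simp add: tutte_y_def pcompose_diff pcompose_pCons one_pCons)
    then show ?case by (simp add: Suc pcompose_mult monom_Suc)
  qed (simp add: monom_0 one_pCons)
  have z: "pcompose ([:-1, 1:] ^ a) [:1, 1:] = (monom 1 a :: int poly)"
  proof (induction a)
    case (Suc a)
    have "pcompose [:-1, 1:] [:1, 1:] = ([:0, 1:] :: int poly)"
      by (simp add: pcompose_pCons)
    then show ?case by (simp only: Suc pcompose_mult power_Suc) (simp add: monom_Suc)
  qed (simp add: monom_0 one_pCons)
  have "pcompose (corank_nullity_monom a b) [:1, 1:] = smult ([:-1, 1:] ^ a) (monom 1 b)"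
    using y by (simp add: x pcompose_smult)
  then show ?thesis by (auto simp: shifted_coeff_def z)
qed

section \<open>Expansion in a basis that depends only on rank and size\<close>

lemma sum_over_Pow_by_card:
  fixes g :: "nat \<Rightarrow> 'b::comm_ring_1"
  assumes "finite E"
  shows "(\<Sum>A\<in>Pow E. g (card A)) = (\<Sum>m\<le>card E. of_nat (card E choose m) * g m)"
proof -
  have "(\<Sum>A\<in>Pow E. g (card A)) = (\<Sum>m\<le>card E. \<Sum>A\<in>{A \<in> Pow E. card A = m}. g (card A))"
    by (rule sum.group[symmetric]) (use assms in \<open>auto intro: card_mono\<close>)
  also have "\<dots> = (\<Sum>m\<le>card E. of_nat (card E choose m) * g m)"
  proof (rule sum.cong[OF refl])
    fix m
    have "(\<Sum>A\<in>{A \<in> Pow E. card A = m}. g (card A)) = of_nat (card {A. A \<subseteq> E \<and> card A = m}) * g m"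
      by simp
    then show "(\<Sum>A\<in>{A \<in> Pow E. card A = m}. g (card A)) = of_nat (card E choose m) * g m"
      using n_subsets[OF assms, of m] by simp
  qed
  finally show ?thesis .
qed

text \<open>The index \<open>(0, 0)\<close> stands for the uniform matroid; it carries the part of a Tutte
  polynomial that depends only on \<open>k\<close> and \<open>n\<close>. In the other basis vectors, the truncated
  subtractions cancel the common factors of the two variables, so that those vectors vanish if
  \<open>i = 0\<close> or \<open>j = 0\<close>.\<close>

definition tutte_indices :: "nat \<Rightarrow> nat \<Rightarrow> (nat \<times> nat) set" where
  "tutte_indices k n = insert (0, 0) ({1..k} \<times> {1..n - k})"

definition tutte_basis :: "nat \<Rightarrow> nat \<Rightarrow> nat \<times> nat \<Rightarrow> int poly poly" where
  "tutte_basis k n q = (if q = (0, 0)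
     then \<Sum>m\<le>n. of_nat (n choose m) * corank_nullity_monom (k - m) (m - k)
     else corank_nullity_monom (fst q) (snd q)
            - corank_nullity_monom (fst q - snd q) (snd q - fst q))"

text \<open>Away from the origin this is the coefficient of a corank-nullity monomial. At the origin
  it is 1, because each Tutte polynomial contains the common uniform part exactly once.\<close>

definition tutte_coord :: "'a matroid \<Rightarrow> nat \<times> nat \<Rightarrow> int" where
  "tutte_coord M q = (if q = (0, 0) then 1
     else int (card {A. A \<subseteq> ground M \<and> matroid_rank M - mrank M A = fst q
                      \<and> card A - mrank M A = snd q}))"

lemma finite_tutte_indices [simp]: "finite (tutte_indices k n)"
  by (simp add: tutte_indices_def)

text \<open>For positive \<open>i\<close> and \<open>j\<close> the coefficient of
  \<open>X^i Y^j\<close> sees only the vector with index \<open>(i, j)\<close>: all other monomials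
  that occur have another bidegree or miss one of the two variables. This kills every coefficient
  except the one at the origin.\<close>

lemma tutte_basis_independent:
  assumes zero: "(\<Sum>q\<in>tutte_indices k n. of_int (u q) * tutte_basis k n q) = 0"
    and q: "q \<in> tutte_indices k n"
  shows "u q = 0"
proof -
  define P where "P = {1..k} \<times> {1..n - k}"
  have S: "shifted_coeff i j (tutte_basis k n (0, 0))
    = (\<Sum>m\<le>n. int (n choose m) * (if i = k - m \<and> j = m - k then 1 else 0))" for i j
    unfolding tutte_basis_def
    by (simp add: shifted_coeff_sum shifted_coeff_monom
          shifted_coeff_of_int_mult[of _ _ "int _", simplified of_int_of_nat_eq])
  have u: "u p = 0" if p: "p \<in> P" for p
  proof -
    obtain i j where ij: "p = (i, j)" "i \<ge> 1" "j \<ge> 1" using p by (auto simp: P_def)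
    have c: "shifted_coeff i j (tutte_basis k n r) = (if r = p then 1 else 0)"
      if r: "r \<in> tutte_indices k n" for r
    proof (cases "r = (0, 0)")
      case True
      have "shifted_coeff i j (tutte_basis k n (0, 0)) = 0"
        unfolding S by (rule sum.neutral) (use ij in auto)
      then show ?thesis using True ij by auto
    next
      case False
      have "\<not> (i = fst r - snd r \<and> j = snd r - fst r)" using ij by linarith
      then have "shifted_coeff i j (tutte_basis k n r) = (if i = fst r \<and> j = snd r then 1 else 0)"
        using False by (simp only: tutte_basis_def if_False shifted_coeff_diff shifted_coeff_monom)
      then show ?thesis using ij by (cases r) auto
    qed
    have "0 = (\<Sum>r\<in>tutte_indices k n. u r * shifted_coeff i j (tutte_basis k n r))"
      using arg_cong[OF zero, of "shifted_coeff i j"]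
      by (simp add: shifted_coeff_sum shifted_coeff_of_int_mult shifted_coeff_0)
    also have "\<dots> = (\<Sum>r\<in>tutte_indices k n. if r = p then u p else 0)"
      by (rule sum.cong) (auto simp: c)
    also have "\<dots> = u p" using p by (simp add: tutte_indices_def P_def)
    finally show ?thesis by simp
  qed
  have "0 = (\<Sum>r\<in>tutte_indices k n. of_int (u r) * tutte_basis k n r)" using zero by simp
  also have "\<dots> = (\<Sum>r\<in>{(0, 0)}. of_int (u r) * tutte_basis k n r)"
    by (rule sum.mono_neutral_right) (use u in \<open>auto simp: tutte_indices_def P_def\<close>)
  finally have "u (0, 0) * shifted_coeff k 0 (tutte_basis k n (0, 0)) = 0"
    using shifted_coeff_of_int_mult[of k 0 "u (0, 0)" "tutte_basis k n (0, 0)"]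
    by (auto simp: shifted_coeff_0)
  \<comment> \<open>The coefficient of \<open>X^k\<close> isolates the term \<open>m = 0\<close>,
    that is, the contribution of the empty set.\<close>
  moreover have "shifted_coeff k 0 (tutte_basis k n (0, 0)) = 1"
  proof -
    have "(k = k - m \<and> 0 = m - k) \<longleftrightarrow> m = 0" for m by auto
    then show ?thesis unfolding S by (simp add: if_distrib[of "\<lambda>x. _ * x"] cong: if_cong)
  qed
  ultimately show ?thesis using u q by (auto simp: tutte_indices_def P_def)
qed

context finite_matroid
begin

lemma tutte_expansion:
  assumes k: "matroid_rank M = k" and n: "card E = n"
  shows "tutte M = (\<Sum>q\<in>tutte_indices k n. of_int (tutte_coord M q) * tutte_basis k n q)"
proof -
  define P where "P = {1..k} \<times> {1..n - k}"
  define D where "D q = corank_nullity_monom (fst q) (snd q)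
    - corank_nullity_monom (fst q - snd q) (snd q - fst q)" for q
  define cn where "cn A = (k - rk A, card A - rk A)" for A
  have rkE: "rk E = k" using k by (simp add: matroid_rank_def)
  have D0: "D (i, j) = 0" if "i = 0 \<or> j = 0" for i j using that by (auto simp: D_def)
  have cn_P: "cn A \<in> P \<or> D (cn A) = 0" if A: "A \<subseteq> E" for A
  proof -
    have fA: "finite A" using A finite_ground finite_subset by blast
    \<comment> \<open>Adding the missing elements one by one shows that the nullity of
      \<open>A\<close> is at most \<open>n - k\<close>. So \<open>cn A\<close> leaves
      \<open>P\<close> only along an axis, where \<open>D\<close> vanishes.\<close>
    have "rk E \<le> rk A + card (E - A)"
      using mrank_Un_le[of "E - A" A] A by (simp add: Un_absorb1)
    moreover have "card (E - A) = n - card A" "card A \<le> n"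
      using card_Diff_subset[OF fA A] card_mono[OF finite_ground A] n by auto
    ultimately have "card A - rk A \<le> n - k" using rkE mrank_le_card[OF fA] by simp
    then show ?thesis using D0[of "k - rk A" "card A - rk A"]
      by (cases "k - rk A = 0 \<or> card A - rk A = 0") (auto simp: cn_def P_def)
  qed
  have "tutte M = (\<Sum>A\<in>Pow E. D (cn A)) + (\<Sum>A\<in>Pow E. corank_nullity_monom (k - card A) (card A - k))"
    unfolding tutte_def sum.distrib[symmetric]
  proof (rule sum.cong[OF refl])
    fix A assume A: "A \<in> Pow E"
    then have "rk A \<le> k" "rk A \<le> card A"
      using mrank_mono[of A E] rkE mrank_le_card[of A] finite_subset[OF _ finite_ground] by auto
    \<comment> \<open>Corank minus nullity is \<open>k - card A\<close>, so the reduced exponents no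
      longer depend on the rank of \<open>A\<close>.\<close>
    then have "k - rk A - (card A - rk A) = k - card A" "card A - rk A - (k - rk A) = card A - k"
      by auto
    then show "corank_nullity_monom (rk E - rk A) (card A - rk A)
        = D (cn A) + corank_nullity_monom (k - card A) (card A - k)"
      by (simp add: D_def cn_def rkE)
  qed
  also have "(\<Sum>A\<in>Pow E. corank_nullity_monom (k - card A) (card A - k)) = tutte_basis k n (0, 0)"
    using sum_over_Pow_by_card[of E "\<lambda>m. corank_nullity_monom (k - m) (m - k)"] n
    by (simp add: tutte_basis_def)
  also have "(\<Sum>A\<in>Pow E. D (cn A)) = (\<Sum>A\<in>{A \<in> Pow E. cn A \<in> P}. D (cn A))"
    by (rule sum.mono_neutral_right) (use cn_P in auto)
  also have "\<dots> = (\<Sum>q\<in>P. \<Sum>A\<in>{A \<in> {A \<in> Pow E. cn A \<in> P}. cn A = q}. D (cn A))"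
    by (rule sum.group[symmetric]) (auto simp: P_def)
  also have "\<dots> = (\<Sum>q\<in>P. of_int (tutte_coord M q) * tutte_basis k n q)"
  proof (rule sum.cong[OF refl])
    fix q assume q: "q \<in> P"
    have "{A \<in> {A \<in> Pow E. cn A \<in> P}. cn A = q}
        = {A. A \<subseteq> E \<and> k - rk A = fst q \<and> card A - rk A = snd q}"
      using q by (auto simp: cn_def)
    moreover have "q \<noteq> (0, 0)" using q by (auto simp: P_def)
    moreover have "(\<Sum>A\<in>{A \<in> {A \<in> Pow E. cn A \<in> P}. cn A = q}. D (cn A))
        = (\<Sum>A\<in>{A \<in> {A \<in> Pow E. cn A \<in> P}. cn A = q}. D q)"
      by (rule sum.cong) auto
    ultimately show "(\<Sum>A\<in>{A \<in> {A \<in> Pow E. cn A \<in> P}. cn A = q}. D (cn A))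
        = of_int (tutte_coord M q) * tutte_basis k n q"
      by (simp add: tutte_coord_def tutte_basis_def D_def k)
  qed
  finally show ?thesis
    by (simp add: tutte_indices_def P_def tutte_coord_def add.commute)
qed

end

section \<open>Matroids with at most one proper cyclic flat\<close>

text \<open>For \<open>r\<close> at most \<open>card F\<close> this is the direct sum of the uniform
  matroid of rank \<open>r\<close> on \<open>F\<close> and the free matroid on the complement,
  truncated at rank \<open>k\<close>. These are shown to be the cuspidal matroids.\<close>

locale capped_matroid =
  fixes M :: "'a matroid" and F :: "'a set" and k r :: nat
  assumes finite_carrier: "finite (ground M)"
    and cap_subset: "F \<subseteq> ground M"
    and indep_iff: "\<And>X. X \<in> indep M \<longleftrightarrow> X \<subseteq> ground M \<and> card X \<le> k \<and> card (X \<inter> F) \<le> r"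

lemma card_eq_Int_add_Diff: "finite A \<Longrightarrow> card A = card (A \<inter> F) + card (A - F)"
  by (metis Int_Diff_Un Int_Diff_disjoint card_Un_disjoint finite_Diff finite_Int)

text \<open>Augmentation: while the cap on \<open>F\<close> is not reached, any element of
  \<open>Y - X\<close> may be added. Once \<open>X\<close> reaches it, \<open>Y\<close> must have
  more elements outside \<open>F\<close>, and adding one of those leaves the intersection with
  \<open>F\<close> unchanged.\<close>

lemma (in capped_matroid) capped_is_matroid: "is_matroid M"
  unfolding is_matroid_def
proof (intro conjI allI impI ballI)
  fix X Y assume X: "X \<in> indep M" and Y: "Y \<subseteq> X"
  have "finite X" using X finite_carrier finite_subset indep_iff by blast
  then have "card Y \<le> card X" "card (Y \<inter> F) \<le> card (X \<inter> F)"
    using Y by (auto intro!: card_mono)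
  then show "Y \<in> indep M" using X Y indep_iff by auto
next
  fix X Y assume X: "X \<in> indep M" and Y: "Y \<in> indep M" and lt: "card X < card Y"
  have fin: "finite X" "finite Y" using X Y finite_carrier finite_subset indep_iff by blast+
  show "\<exists>e\<in>Y - X. insert e X \<in> indep M"
  proof (cases "card (X \<inter> F) < r")
    case True
    obtain e where e: "e \<in> Y - X" using lt fin card_mono[of X Y] by fastforce
    have "card (insert e X \<inter> F) \<le> Suc (card (X \<inter> F))"
      using fin by (cases "e \<in> F") (auto simp: card_insert_if)
    then have "insert e X \<in> indep M"
      using True X Y e lt fin indep_iff[of X] indep_iff[of Y] indep_iff[of "insert e X"] by auto
    then show ?thesis using e by blast
  next
    case False
    then have "card (X - F) < card (Y - F)"
      using lt Y indep_iff[of Y] fin card_eq_Int_add_Diff[of X F] card_eq_Int_add_Diff[of Y F] by auto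
    then obtain e where e: "e \<in> Y - F" "e \<notin> X - F"
      using fin card_mono[of "X - F" "Y - F"] by fastforce
    have "insert e X \<inter> F = X \<inter> F" using e by auto
    then have "insert e X \<in> indep M"
      using X Y e lt fin indep_iff[of X] indep_iff[of Y] indep_iff[of "insert e X"] by auto
    then show ?thesis using e by blast
  qed
qed (use finite_carrier indep_iff in auto)

sublocale capped_matroid \<subseteq> finite_matroid
  by (rule finite_matroid.intro, rule capped_is_matroid)

context capped_matroid
begin

lemma capped_mrank:
  assumes "A \<subseteq> E"
  shows "rk A = min (card A) (min k (r + card (A - F)))" (is "_ = ?m")
proof (rule antisym)
  have fA: "finite A" using assms finite_ground finite_subset by blast
  obtain B where B: "B \<subseteq> A" "B \<in> indep M" "card B = rk A" using ex_basis by blast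
  have fB: "finite B" using B indep_finite by blast
  have "card B \<le> card A" "card (B - F) \<le> card (A - F)"
    by (rule card_mono, use B(1) fA in auto)+
  moreover have "card (B \<inter> F) \<le> r" "card B \<le> k" using B indep_iff by auto
  ultimately show "rk A \<le> ?m" using B(3) card_eq_Int_add_Diff[OF fB, of F] by simp
  \<comment> \<open>For the lower bound, fill up \<open>F\<close> as far as its cap allows, add
    everything of \<open>A\<close> outside \<open>F\<close>, and cut the result down to the claimed
    size.\<close>
  obtain X1 where X1: "X1 \<subseteq> A \<inter> F" "card X1 = min (card (A \<inter> F)) r"
    by (meson min.cobounded1 obtain_subset_with_card_n)
  have fX1: "finite X1" using X1 fA finite_subset by blast
  have "card (X1 \<union> (A - F)) = card X1 + card (A - F)"
    using X1 fA fX1 by (intro card_Un_disjoint) auto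
  then have "?m \<le> card (X1 \<union> (A - F))"
    using X1 card_eq_Int_add_Diff[OF fA, of F] by auto
  then obtain X where X: "X \<subseteq> X1 \<union> (A - F)" "card X = ?m"
    using obtain_subset_with_card_n by metis
  have "card (X \<inter> F) \<le> card X1" using X fX1 by (intro card_mono) auto
  moreover have "X \<subseteq> A" using X X1 by auto
  ultimately have "X \<in> indep M" using X X1 assms indep_iff by auto
  from card_le_mrank[OF this \<open>X \<subseteq> A\<close>] show "?m \<le> rk A" using X by simp
qed

text \<open>A proper flat has rank below \<open>k\<close>, and a nonempty cyclic set is dependent,
  so in the rank formula only \<open>r + card (Z - F)\<close> can be attained. Elements of
  \<open>F\<close> do not change this value, so flatness puts all of \<open>F\<close> into
  \<open>Z\<close>. Elements outside \<open>F\<close> do count, so cyclicity excludes them from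
  \<open>Z\<close>.\<close>

lemma capped_cyclic_flat:
  assumes "cyclic_flat M Z"
  shows "Z = {} \<or> Z = F \<or> Z = E"
proof (rule ccontr)
  assume "\<not> ?thesis"
  then have ne: "Z \<noteq> {}" "Z \<noteq> F" "Z \<noteq> E" by auto
  have ZE: "Z \<subseteq> E" and flat: "\<And>e. e \<in> E - Z \<Longrightarrow> rk Z < rk (insert e Z)"
    and cyc: "\<And>z. z \<in> Z \<Longrightarrow> rk (Z - {z}) = rk Z"
    using assms cyclic_iff_mrank[of Z] unfolding cyclic_flat_def flat_def by auto
  have fZ: "finite Z" using ZE finite_ground finite_subset by blast
  obtain z e where z: "z \<in> Z" and e: "e \<in> E - Z" using ne ZE by blast
  have "rk (insert e Z) \<le> k" using capped_mrank[of "insert e Z"] ZE e by simp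
  then have lk: "rk Z < k" using flat[OF e] by simp
  have "rk Z \<le> card (Z - {z})" using cyc[OF z] mrank_le_card[of "Z - {z}"] fZ by simp
  then have "rk Z < card Z" using z fZ by (metis card_Diff1_less order_le_less_trans)
  then have rkZ: "rk Z = r + card (Z - F)" using capped_mrank[OF ZE] lk by auto
  have "f \<in> Z" if f: "f \<in> F" for f
  proof (rule ccontr)
    assume "f \<notin> Z"
    moreover have "insert f Z - F = Z - F" using f by auto
    ultimately show False
      using flat[of f] rkZ capped_mrank[of "insert f Z"] ZE cap_subset f by auto
  qed
  moreover have "z \<in> F" if z: "z \<in> Z" for z
  proof (rule ccontr)
    assume "z \<notin> F"
    then have "card (Z - {z} - F) < card (Z - F)"
      using z fZ by (intro psubset_card_mono) auto
    moreover have "Z - {z} \<subseteq> E" using ZE by auto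
    ultimately show False using cyc[OF z] rkZ capped_mrank[of "Z - {z}"] by simp
  qed
  ultimately show False using ne by blast
qed

text \<open>In such a minor, \<open>p\<close> and \<open>c\<close> still raise the rank by two, so
  the cap \<open>k\<close> is slack at \<open>C\<close>. The loop \<open>l\<close> then shows that
  the cap on \<open>F\<close> is tight at \<open>C\<close>. Hence the nonloops \<open>p\<close> and
  \<open>q\<close> lie outside \<open>F\<close>, where together they raise the rank by two, so they
  are not parallel.\<close>

lemma capped_elementary_split: "elementary_split M"
  unfolding elementary_split_def
proof
  assume "\<exists>N. is_minor N M \<and> matroid_iso N U01_U12_U11"
  then obtain C D where C: "C \<subseteq> E"
    and minor: "matroid_iso (mdelete (mcontract M C) D) U01_U12_U11"
    unfolding is_minor_def by blast
  obtain g where bij: "bij_betw g (ground (mdelete (mcontract M C) D)) (ground U01_U12_U11)"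
    and iso: "\<And>X. X \<subseteq> ground (mdelete (mcontract M C) D) \<Longrightarrow>
      X \<in> indep (mdelete (mcontract M C) D) \<longleftrightarrow> g ` X \<in> indep U01_U12_U11"
    using minor unfolding matroid_iso_def by blast
  define G where "G = E - C - D"
  have G: "ground (mdelete (mcontract M C) D) = G"
    by (auto simp: mdelete_def mcontract_def G_def)
  have iso': "rk (X \<union> C) = card X + rk C \<longleftrightarrow> g ` X \<subseteq> {1,2,3} \<and> card (g ` X \<inter> {1,2}) \<le> 1"
    if "X \<subseteq> G" for X
    using iso[of X] that unfolding G by (auto simp: mdelete_def mcontract_def G_def U01_U12_U11_def)
  have im: "g ` G = {0,1,2,3}"
    using bij unfolding G by (simp add: bij_betw_def U01_U12_U11_def)
  have ex: "\<exists>x\<in>G. g x = v" if "v \<in> {0,1,2,3}" for v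
    using that unfolding im[symmetric] by auto
  obtain l where l_G: "l \<in> G" "g l = 0" using ex[of 0] by auto
  obtain p where p_G: "p \<in> G" "g p = 1" using ex[of 1] by auto
  obtain q where q_G: "q \<in> G" "g q = 2" using ex[of 2] by auto
  obtain c where c_G: "c \<in> G" "g c = 3" using ex[of 3] by auto
  note lpqc = l_G p_G q_G c_G
  have dist: "p \<noteq> q" "p \<noteq> c" using lpqc by auto
  have fC: "finite C" using C finite_ground finite_subset by blast
  have l: "rk (insert l C) \<noteq> Suc (rk C)" using iso'[of "{l}"] lpqc by auto
  have p: "rk (insert p C) = Suc (rk C)" using iso'[of "{p}"] lpqc by auto
  have q: "rk (insert q C) = Suc (rk C)" using iso'[of "{q}"] lpqc by auto
  have pq: "rk (insert p (insert q C)) \<noteq> rk C + 2" using iso'[of "{p, q}"] lpqc dist by auto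
  have pc: "rk (insert p (insert c C)) = rk C + 2" using iso'[of "{p, c}"] lpqc dist by auto
  have in_E: "l \<in> E - C" "p \<in> E - C" "q \<in> E - C" "c \<in> E - C" using lpqc by (auto simp: G_def)
  have formula: "rk (insert l C) = min (card (insert l C)) (min k (r + card (insert l C - F)))"
    "rk (insert p C) = min (card (insert p C)) (min k (r + card (insert p C - F)))"
    "rk (insert q C) = min (card (insert q C)) (min k (r + card (insert q C - F)))"
    "rk (insert p (insert q C))
       = min (card (insert p (insert q C))) (min k (r + card (insert p (insert q C) - F)))"
    "rk (insert p (insert c C))
       = min (card (insert p (insert c C))) (min k (r + card (insert p (insert c C) - F)))"
    using C in_E by (auto intro!: capped_mrank)
  have k2: "rk C + 2 \<le> k" using pc formula(5) by linarith
  have rkC: "rk C = min (card C) (min k (r + card (C - F)))" by (rule capped_mrank[OF C])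
  have card_ins: "card (insert x A - F) = (if x \<in> F then card (A - F) else Suc (card (A - F)))"
    if "x \<notin> A" "finite A" for x A using that by (simp add: insert_Diff_if)
  have "rk C = r + card (C - F)"
    using l rkC formula(1) k2 card_ins[of l C] fC in_E by (auto split: if_splits)
  then have "p \<notin> F" "q \<notin> F"
    using p q formula(2,3) card_ins[of p C] card_ins[of q C] fC in_E by (auto split: if_splits)
  then have "rk (insert p (insert q C)) = rk C + 2"
    using formula(4) card_ins[of q C] card_ins[of p "insert q C"] fC in_E dist k2 rkC
      \<open>rk C = r + card (C - F)\<close> by simp
  then show False using pq by simp
qed

lemma capped_cuspidal: "cuspidal M"
  unfolding cuspidal_def schubert_def
proof (intro conjI allI impI capped_elementary_split)
  fix Y Z assume "cyclic_flat M Y" "cyclic_flat M Z"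
  then show "Y \<subseteq> Z \<or> Z \<subseteq> Y"
    using capped_cyclic_flat[of Y] capped_cyclic_flat[of Z] cap_subset by blast
qed

end

section \<open>Isomorphisms between capped matroids\<close>

lemma capped_matroids_iso:
  assumes "capped_matroid M F k r" "capped_matroid M' F' k r"
    and cards: "card F = card F'" "card (ground M) = card (ground M')"
  shows "matroid_iso M M'"
proof -
  interpret M: capped_matroid M F k r by fact
  interpret M': capped_matroid M' F' k r by fact
  have fin: "finite F" "finite F'"
    using M.cap_subset M'.cap_subset finite_subset M.finite_ground M'.finite_ground by blast+
  have "card (ground M - F) = card (ground M' - F')"
    using cards fin M.cap_subset M'.cap_subset by (simp add: card_Diff_subset)
  then obtain g where g: "bij_betw g (ground M - F) (ground M' - F')"
    using finite_same_card_bij[of "ground M - F" "ground M' - F'"] by auto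
  obtain f where f: "bij_betw f F F'" using finite_same_card_bij[OF fin] cards by auto
  define h where "h x = (if x \<in> F then f x else g x)" for x
  have hF: "bij_betw h F F'" using f by (rule bij_betw_cong[THEN iffD1, rotated]) (simp add: h_def)
  have hG: "bij_betw h (ground M - F) (ground M' - F')"
    using g by (rule bij_betw_cong[THEN iffD1, rotated]) (simp add: h_def)
  have h: "bij_betw h (ground M) (ground M')"
    using bij_betw_combine[OF hF hG] M.cap_subset M'.cap_subset by (simp add: Un_absorb1)
  \<comment> \<open>Independence depends only on two cardinalities, and the bijection glued from
    \<open>F\<close> and its complement preserves both.\<close>
  show ?thesis
    unfolding matroid_iso_def
  proof (intro exI conjI allI impI)
    show "bij_betw h (ground M) (ground M')" by (rule h)
    fix X assume X: "X \<subseteq> ground M"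
    have inj: "inj_on h (ground M)" using h by (simp add: bij_betw_def)
    have "h ` X \<inter> F' = h ` (X \<inter> F)"
      using X hF hG by (auto simp: bij_betw_def)
    then have "card (h ` X \<inter> F') = card (X \<inter> F)" "card (h ` X) = card X"
      using inj X by (metis card_image inj_on_subset inf.coboundedI1)
        (use inj X in \<open>metis card_image inj_on_subset\<close>)
    moreover have "h ` X \<subseteq> ground M'" using h X by (auto simp: bij_betw_def)
    ultimately show "X \<in> indep M \<longleftrightarrow> h ` X \<in> indep M'"
      using X by (simp add: M.indep_iff M'.indep_iff)
  qed
qed

text \<open>Lets an explicitly constructed matroid hand its parameters to the representative of its
  isomorphism class; the image of \<open>F\<close> is the new cap.\<close>

lemma capped_matroid_transfer:
  assumes "capped_matroid M F k r" "matroid_iso M M'" "is_matroid M'"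
  shows "\<exists>F'. capped_matroid M' F' k r \<and> card F' = card F"
proof -
  interpret M: capped_matroid M F k r by fact
  interpret M': finite_matroid M' by standard fact
  obtain h where h: "bij_betw h (ground M) (ground M')"
    and iso: "\<And>X. X \<subseteq> ground M \<Longrightarrow> X \<in> indep M \<longleftrightarrow> h ` X \<in> indep M'"
    using assms(2) unfolding matroid_iso_def by blast
  have inj: "inj_on h (ground M)" using h by (simp add: bij_betw_def)
  have "capped_matroid M' (h ` F) k r"
  proof
    show "h ` F \<subseteq> ground M'" using h M.cap_subset by (auto simp: bij_betw_def)
    fix Y
    show "Y \<in> indep M' \<longleftrightarrow> Y \<subseteq> ground M' \<and> card Y \<le> k \<and> card (Y \<inter> h ` F) \<le> r"
    proof (cases "Y \<subseteq> ground M'")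
      case True
      then obtain X where X: "X \<subseteq> ground M" "Y = h ` X"
        using h by (metis bij_betw_def subset_imageE)
      have "h ` X \<inter> h ` F = h ` (X \<inter> F)"
        using inj_on_image_Int[OF inj X(1) M.cap_subset] by simp
      then have "card (Y \<inter> h ` F) = card (X \<inter> F)" "card Y = card X"
        unfolding X(2) using inj X
        by (metis card_image inj_on_subset inf.coboundedI1)
          (use inj X in \<open>metis card_image inj_on_subset\<close>)
      then show ?thesis using iso[OF X(1)] X True M.indep_iff by auto
    qed (use M'.indep_subset_ground in blast)
  qed simp
  moreover have "card (h ` F) = card F"
    using inj M.cap_subset card_image inj_on_subset by blast
  ultimately show ?thesis by blast
qed

section \<open>Classification of cuspidal matroids\<close>

text \<open>Contract \<open>C\<close> and delete all other elements except the four. Since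
  \<open>C\<close> is independent, \<open>X\<close> is independent in the contraction exactly if
  \<open>X\<close> together with \<open>C\<close> is independent in \<open>M\<close>; the maximal
  such \<open>X\<close> are \<open>{p, c}\<close> and \<open>{q, c}\<close>.\<close>

lemma U01_U12_U11_minorI:
  assumes M: "is_matroid M" and C: "C \<in> indep M"
    and elems: "distinct [l, p, q, c]" "{l, p, q, c} \<subseteq> ground M - C"
    and loop: "insert l C \<notin> indep M"
    and parallel: "insert p (insert q C) \<notin> indep M"
    and coloop: "insert p (insert c C) \<in> indep M" "insert q (insert c C) \<in> indep M"
  shows "\<not> elementary_split M"
proof -
  interpret finite_matroid M by standard fact
  define G where "G = {l, p, q, c}"
  define D where "D = E - C - G"
  define N where "N = mdelete (mcontract M C) D"
  have GE: "G \<subseteq> E - C" using elems by (simp add: G_def)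
  have CE: "C \<subseteq> E" using indep_subset_ground C by blast
  have fin: "finite C" using C indep_finite by blast
  have ground_N: "ground N = G"
    using GE by (auto simp: N_def mdelete_def mcontract_def D_def)
  have indep_N: "X \<in> indep N \<longleftrightarrow> l \<notin> X \<and> \<not> (p \<in> X \<and> q \<in> X)" if X: "X \<subseteq> G" for X
  proof -
    have "finite X" using X by (rule finite_subset) (simp add: G_def)
    moreover have "X \<inter> C = {}" using X GE by blast
    ultimately have card: "card (X \<union> C) = card X + card C"
      using fin by (simp add: card_Un_disjoint)
    have "X \<in> indep N \<longleftrightarrow> rk (X \<union> C) = card X + card C"
      using X GE mrank_indep[OF C] by (auto simp: N_def mdelete_def mcontract_def D_def)
    also have "\<dots> \<longleftrightarrow> X \<union> C \<in> indep M"
      using indep_iff_mrank[of "X \<union> C"] card X GE CE by auto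
    also have "\<dots> \<longleftrightarrow> l \<notin> X \<and> \<not> (p \<in> X \<and> q \<in> X)"
    proof
      assume ind: "X \<union> C \<in> indep M"
      show "l \<notin> X \<and> \<not> (p \<in> X \<and> q \<in> X)"
        using indep_subset[OF ind, of "insert l C"] indep_subset[OF ind, of "insert p (insert q C)"]
          loop parallel by blast
    next
      assume "l \<notin> X \<and> \<not> (p \<in> X \<and> q \<in> X)"
      then have "X \<union> C \<subseteq> insert p (insert c C) \<or> X \<union> C \<subseteq> insert q (insert c C)"
        using X by (auto simp: G_def)
      then show "X \<union> C \<in> indep M" using coloop indep_subset by blast
    qed
    finally show ?thesis .
  qed
  \<comment> \<open>The default value 0 is the image of the loop \<open>l\<close>.\<close>
  define h :: "'a \<Rightarrow> nat" where "h = (\<lambda>_. 0)(p := 1, q := 2, c := 3)"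
  have h: "h l = 0" "h p = 1" "h q = 2" "h c = 3" using elems by (auto simp: h_def)
  have inj: "inj_on h G" using elems by (auto simp: G_def h inj_on_def)
  have "matroid_iso N U01_U12_U11"
    unfolding matroid_iso_def
  proof (intro exI conjI allI impI)
    show "bij_betw h (ground N) (ground U01_U12_U11)"
      using inj by (auto simp: bij_betw_def ground_N U01_U12_U11_def G_def h)
    fix X assume "X \<subseteq> ground N"
    then have X: "X \<subseteq> G" by (simp add: ground_N)
    have "h x \<in> {1,2,3} \<longleftrightarrow> x \<noteq> l" if "x \<in> G" for x
      using that h elems by (auto simp: G_def)
    then have 1: "h ` X \<subseteq> {1,2,3} \<longleftrightarrow> l \<notin> X" using X by blast
    have "h ` X \<inter> {1,2} = h ` (X \<inter> {p, q})" using X h by (auto simp: G_def)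
    moreover have "inj_on h (X \<inter> {p, q})" using inj X by (meson inf.coboundedI1 inj_on_subset)
    ultimately have "card (h ` X \<inter> {1,2}) = card (X \<inter> {p, q})" by (simp add: card_image)
    moreover have "card (X \<inter> {p, q}) \<le> 1 \<longleftrightarrow> \<not> (p \<in> X \<and> q \<in> X)"
      using elems by (cases "p \<in> X"; cases "q \<in> X") auto
    ultimately show "X \<in> indep N \<longleftrightarrow> h ` X \<in> indep U01_U12_U11"
      using indep_N[OF X] 1 by (simp add: U01_U12_U11_def)
  qed
  moreover have "is_minor N M"
    unfolding is_minor_def N_def using CE by (intro exI[of _ C] exI[of _ D]) (auto simp: D_def)
  ultimately show ?thesis unfolding elementary_split_def by blast
qed

context finite_matroid
begin

text \<open>Two nested cyclic flats other than the empty set and the ground set yield the excluded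
  minor: an element of the smaller one becomes the loop, two elements of the difference become
  parallel, and an element outside of the larger one becomes the coloop.\<close>
lemma nested_cyclic_flats_not_elementary_split:
  assumes F: "cyclic_flat M F" and G: "cyclic_flat M G"
    and ne: "F \<noteq> {}" "F \<subset> G" "G \<noteq> E"
  shows "\<not> elementary_split M"
proof -
  have FE: "F \<subseteq> E" and GE: "G \<subseteq> E"
    and flatF: "\<And>e. e \<in> E - F \<Longrightarrow> rk F < rk (insert e F)"
    and flatG: "\<And>e. e \<in> E - G \<Longrightarrow> rk G < rk (insert e G)"
    using F G unfolding cyclic_flat_def flat_def by auto
  have cycF: "\<And>z. z \<in> F \<Longrightarrow> rk (F - {z}) = rk F" and cycG: "\<And>z. z \<in> G \<Longrightarrow> rk (G - {z}) = rk G"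
    using F G cyclic_iff_mrank[OF FE] cyclic_iff_mrank[OF GE] unfolding cyclic_flat_def by auto
  obtain l where l: "l \<in> F" using ne by blast
  obtain p where p: "p \<in> G" "p \<notin> F" using ne by blast
  obtain c where c: "c \<in> E" "c \<notin> G" using ne GE by blast
  \<comment> \<open>By cyclicity some basis of \<open>F\<close> avoids \<open>l\<close>, so
    \<open>l\<close> becomes a loop once this basis is contracted.\<close>
  obtain I where I: "I \<subseteq> F - {l}" "I \<in> indep M" "card I = rk F"
    using ex_basis[of "F - {l}"] cycF[OF l] by auto
  have lI: "insert l I \<notin> indep M"
  proof
    assume "insert l I \<in> indep M"
    then have "card (insert l I) \<le> rk F" using card_le_mrank[of "insert l I" F] I l by auto
    moreover have "l \<notin> I" using I by blast
    ultimately show False using I indep_finite[OF I(2)] by simp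
  qed
  \<comment> \<open>Cyclicity of \<open>G\<close> gives a basis of \<open>G\<close> that avoids
    \<open>p\<close> and extends \<open>I\<close>. Exchanging \<open>p\<close> into it while keeping
    \<open>I\<close> yields a second basis \<open>B'\<close>.\<close>
  obtain B where B: "I \<subseteq> B" "B \<subseteq> G - {p}" "B \<in> indep M" "card B = rk G"
    using ex_basis_extending[of I "G - {p}"] I ne p cycG[OF p(1)] by auto
  have fB: "finite B" using B indep_finite by blast
  have "insert p I \<in> indep M" using insert_basis_indep[of I F p] I flatF[of p] p GE by auto
  then obtain B' where B': "insert p I \<subseteq> B'" "B' \<subseteq> insert p B" "B' \<in> indep M"
      "card B' = rk (insert p B)"
    using ex_basis_extending[of "insert p I" "insert p B"] B by blast
  have "rk G = rk B" using mrank_indep[OF B(3)] B(4) by simp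
  moreover have "rk B \<le> rk (insert p B)" "rk (insert p B) \<le> rk G"
    using B p by (auto intro!: mrank_mono)
  ultimately have rkpB: "rk (insert p B) = rk G" by simp
  have cB': "card B' = card B" using B'(4) rkpB B(4) by simp
  have pB: "p \<notin> B" using B by blast
  have "B' \<noteq> insert p B" using cB' pB fB by auto
  \<comment> \<open>The element exchanged for \<open>p\<close> is not in \<open>I\<close>. The
    common part \<open>C\<close> of the two bases thus contains \<open>I\<close>, and
    \<open>p\<close> and \<open>q\<close> are parallel over \<open>C\<close>.\<close>
  then obtain q where q: "q \<in> B" "q \<notin> B'" using B' by blast
  define C where "C = B - {q}"
  have "B' = insert p C"
  proof (rule card_subset_eq)
    show "finite (insert p C)" "B' \<subseteq> insert p C" using fB B' q by (auto simp: C_def)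
    have "card B > 0" using q fB by (auto simp: card_gt_0_iff)
    then show "card B' = card (insert p C)" using cB' fB q pB by (simp add: C_def)
  qed
  then have pC: "insert p C \<in> indep M" using B' by simp
  have qC: "insert q C = B" using q by (auto simp: C_def)
  have IC: "I \<subseteq> C" using B B' q by (auto simp: C_def)
  have "insert c (insert p C) \<in> indep M"
    using insert_basis_indep[of "insert p C" G c] pC flatG[of c] c B p cB' B(4) \<open>B' = insert p C\<close>
    by (auto simp: C_def)
  moreover have "insert c (insert q C) \<in> indep M"
    unfolding qC using insert_basis_indep[of B G c] B flatG[of c] c by auto
  moreover have "insert l C \<notin> indep M" using lI IC indep_subset by blast
  moreover have "insert p (insert q C) \<notin> indep M"
    unfolding qC using card_le_mrank[of "insert p B" G] B pB fB p by auto
  moreover have "l \<notin> B" using lI B(1,3) indep_subset by blast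
  moreover have "C \<in> indep M" using pC indep_subset by blast
  ultimately show ?thesis
    using l p q c pB ne FE GE B
    by (intro U01_U12_U11_minorI[OF is_matroid, of C l p q c])
      (auto simp: C_def insert_commute)
qed

end

text \<open>The index is the pair of corank and nullity of \<open>F\<close>. For \<open>(0, 0)\<close> the bound on the
  intersection with the \<open>k\<close>-set \<open>F\<close> is vacuous and the matroid is uniform.\<close>

definition cuspidal_type :: "nat \<Rightarrow> nat \<times> nat \<Rightarrow> 'a matroid \<Rightarrow> bool" where
  "cuspidal_type k p M \<longleftrightarrow>
     (\<exists>F. capped_matroid M F k (k - fst p) \<and> card F = k - fst p + snd p)"

text \<open>Cyclic flats form a chain, and two proper nonempty ones would give the excluded minor,
  so at most one such \<open>F\<close> exists. By \<open>dependent_ex_cyclic_flat\<close> the rank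
  bounds on \<open>F\<close> and on the ground set then decide independence.\<close>

lemma (in finite_matroid) cuspidal_ex_type:
  assumes "cuspidal M" "matroid_rank M = k" "card E = n"
  shows "\<exists>p\<in>tutte_indices k n. cuspidal_type k p M"
proof -
  have rkE: "rk E = k" using assms(2) by (simp add: matroid_rank_def)
  have kn: "k \<le> n" using mrank_le_card[of E] rkE assms(3) by simp
  have indep_card: "card X \<le> k" if "X \<in> indep M" for X
    using card_le_mrank[OF that, of E] indep_subset_ground[OF that] rkE by simp
  show ?thesis
  proof (cases "\<exists>F. cyclic_flat M F \<and> F \<noteq> {} \<and> F \<noteq> E")
    case False
    \<comment> \<open>Any \<open>k\<close>-subset will do: the cap \<open>k\<close> on it follows
      from the bound on the whole set.\<close>
    obtain F where F: "F \<subseteq> E" "card F = k"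
      using obtain_subset_with_card_n[of k E] kn assms(3) by metis
    have "capped_matroid M F k k"
    proof
      fix X
      show "X \<in> indep M \<longleftrightarrow> X \<subseteq> E \<and> card X \<le> k \<and> card (X \<inter> F) \<le> k"
      proof (intro iffI conjI)
        assume X: "X \<subseteq> E \<and> card X \<le> k \<and> card (X \<inter> F) \<le> k"
        show "X \<in> indep M"
        proof (rule ccontr)
          assume "X \<notin> indep M"
          then obtain Z where "cyclic_flat M Z" "Z \<noteq> {}" "rk Z < card (X \<inter> Z)"
            using dependent_ex_cyclic_flat X by blast
          moreover from this have "Z = E" using False by blast
          ultimately show False using X rkE by (simp add: Int_absorb2)
        qed
      next
        assume X: "X \<in> indep M"
        show "X \<subseteq> E" "card X \<le> k" using X indep_subset_ground indep_card by auto
        show "card (X \<inter> F) \<le> k" using indep_card[OF indep_subset[OF X, of "X \<inter> F"]] by simp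
      qed
    qed (use F in auto)
    then have "cuspidal_type k (0, 0) M" using F by (auto simp: cuspidal_type_def)
    then show ?thesis by (auto simp: tutte_indices_def)
  next
    case True
    then obtain F where F: "cyclic_flat M F" "F \<noteq> {}" "F \<noteq> E" by blast
    have FE: "F \<subseteq> E" and flat: "\<And>e. e \<in> E - F \<Longrightarrow> rk F < rk (insert e F)"
      using F unfolding cyclic_flat_def flat_def by auto
    have fF: "finite F" using FE finite_ground finite_subset by blast
    have cyc: "\<And>z. z \<in> F \<Longrightarrow> rk (F - {z}) = rk F"
      using F cyclic_iff_mrank[OF FE] unfolding cyclic_flat_def by auto
    have only: "Z = F \<or> Z = E" if "cyclic_flat M Z" "Z \<noteq> {}" for Z
    proof (rule ccontr)
      assume "\<not> (Z = F \<or> Z = E)"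
      moreover have "Z \<subseteq> F \<or> F \<subseteq> Z"
        using assms(1) that F unfolding cuspidal_def schubert_def by blast
      ultimately have "\<not> elementary_split M"
        using nested_cyclic_flats_not_elementary_split[of Z F]
          nested_cyclic_flats_not_elementary_split[of F Z] that F by blast
      then show False using assms(1) by (simp add: cuspidal_def)
    qed
    obtain e where e: "e \<in> E - F" using F FE by blast
    obtain z where z: "z \<in> F" using F by blast
    have r_less_k: "rk F < k"
      using flat[OF e] mrank_mono[of "insert e F" E] rkE FE e by fastforce
    have "rk F \<le> card (F - {z})" using cyc[OF z] mrank_le_card[of "F - {z}"] fF by simp
    then have r_less: "rk F < card F" using z fF by (metis card_Diff1_less order_le_less_trans)
    have "k \<le> rk F + card (E - F)"
      using mrank_Un_le[of "E - F" F] FE rkE by (simp add: Un_absorb1)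
    moreover have "card (E - F) = n - card F" "card F \<le> n"
      using card_Diff_subset[OF fF FE] card_mono[OF finite_ground FE] assms(3) by auto
    ultimately have le: "card F - rk F \<le> n - k" using r_less by simp
    have "capped_matroid M F k (rk F)"
    proof
      fix X
      show "X \<in> indep M \<longleftrightarrow> X \<subseteq> E \<and> card X \<le> k \<and> card (X \<inter> F) \<le> rk F"
      proof (intro iffI conjI)
        assume X: "X \<subseteq> E \<and> card X \<le> k \<and> card (X \<inter> F) \<le> rk F"
        show "X \<in> indep M"
        proof (rule ccontr)
          assume "X \<notin> indep M"
          then obtain Z where Z: "cyclic_flat M Z" "Z \<noteq> {}" "rk Z < card (X \<inter> Z)"
            using dependent_ex_cyclic_flat X by blast
          from only[OF Z(1,2)] show False
          proof
            assume "Z = E"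
            then show False using X Z rkE by (simp add: Int_absorb2)
          qed (use X Z in simp)
        qed
      next
        assume X: "X \<in> indep M"
        show "X \<subseteq> E" "card X \<le> k" using X indep_subset_ground indep_card by auto
        show "card (X \<inter> F) \<le> rk F"
          using card_le_mrank[OF indep_subset[OF X, of "X \<inter> F"], of F] by simp
      qed
    qed (use FE in auto)
    then have "cuspidal_type k (k - rk F, card F - rk F) M"
      using r_less_k r_less by (auto simp: cuspidal_type_def)
    moreover have "(k - rk F, card F - rk F) \<in> tutte_indices k n"
      using r_less_k r_less le by (auto simp: tutte_indices_def)
    ultimately show ?thesis by blast
  qed
qed

text \<open>Since \<open>snd p\<close> is at most \<open>n - k\<close>, at least
  \<open>fst p\<close> elements lie outside \<open>F\<close>, enough to fill the cap on
  \<open>F\<close> up to \<open>k\<close>.\<close>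

lemma cuspidal_type_rank:
  assumes "cuspidal_type k p M" "p \<in> tutte_indices k n" "card (ground M) = n" "k \<le> n"
  shows "matroid_rank M = k"
proof -
  obtain F where F: "capped_matroid M F k (k - fst p)" "card F = k - fst p + snd p"
    using assms(1) by (auto simp: cuspidal_type_def)
  interpret capped_matroid M F k "k - fst p" by fact
  have "card (E - F) = n - card F"
    using cap_subset assms(3) finite_subset[OF cap_subset] by (simp add: card_Diff_subset)
  then show ?thesis using capped_mrank[of E] F(2) assms(2-4)
    by (auto simp: matroid_rank_def tutte_indices_def)
qed

lemma ex_cuspidal_type:
  fixes E :: "'a set"
  assumes "finite E" "card E = n" "k \<le> n" "p \<in> tutte_indices k n"
  shows "\<exists>M. ground M = E \<and> cuspidal_type k p M"
proof -
  have "k - fst p + snd p \<le> card E" using assms by (auto simp: tutte_indices_def)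
  then obtain F where F: "F \<subseteq> E" "card F = k - fst p + snd p"
    using obtain_subset_with_card_n by metis
  define M where
    "M = \<lparr>ground = E, indep = {X. X \<subseteq> E \<and> card X \<le> k \<and> card (X \<inter> F) \<le> k - fst p}\<rparr>"
  have "capped_matroid M F k (k - fst p)"
    by standard (use F assms(1) in \<open>auto simp: M_def\<close>)
  then show ?thesis using F by (intro exI[of _ M]) (auto simp: cuspidal_type_def M_def)
qed

text \<open>If corank and nullity of \<open>A\<close> are both positive, the rank formula must
  attain \<open>r + card (A - F)\<close> with \<open>r = k - fst p\<close>. The corank is then
  \<open>fst p - card (A - F)\<close> and the nullity \<open>card (A \<inter> F) - r\<close>. Both
  are maximal only for \<open>A = F\<close>.\<close>

lemma tutte_coord_cuspidal_type:
  assumes "cuspidal_type k p M" "p \<in> tutte_indices k n" "card (ground M) = n" "k \<le> n"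
  shows "tutte_coord M p = 1"
    and "q \<in> tutte_indices k n \<Longrightarrow> tutte_coord M q \<noteq> 0 \<Longrightarrow> fst q \<le> fst p \<and> snd q \<le> snd p"
proof -
  obtain F where F: "capped_matroid M F k (k - fst p)" "card F = k - fst p + snd p"
    using assms(1) by (auto simp: cuspidal_type_def)
  interpret capped_matroid M F k "k - fst p" by fact
  have rank: "matroid_rank M = k" using cuspidal_type_rank assms by blast
  have fF: "finite F" using cap_subset finite_ground finite_subset by blast
  have bounds: "fst q = fst p - card (A - F) \<and> snd q = card (A \<inter> F) - (k - fst p)
      \<and> card (A - F) < fst p \<and> k - fst p < card (A \<inter> F)"
    if A: "A \<subseteq> E" "k - rk A = fst q" "card A - rk A = snd q" and q: "fst q > 0" "snd q > 0" for A q
  proof -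
    have "finite A" using A finite_ground finite_subset by blast
    moreover have "rk A = k - fst p + card (A - F)"
      using capped_mrank[OF A(1)] A q by auto
    moreover have "fst p \<le> k" using assms(2) by (auto simp: tutte_indices_def)
    ultimately show ?thesis using A q card_eq_Int_add_Diff[of A F] by auto
  qed
  have Int_le: "card (A \<inter> F) \<le> card F" for A using fF by (simp add: card_mono)
  show "tutte_coord M p = 1"
  proof (cases "p = (0, 0)")
    case False
    then have p: "fst p > 0" "snd p > 0" "fst p \<le> k" using assms(2) by (auto simp: tutte_indices_def)
    have "{A. A \<subseteq> E \<and> k - rk A = fst p \<and> card A - rk A = snd p} = {F}"
    proof (intro set_eqI iffI)
      fix A assume "A \<in> {A. A \<subseteq> E \<and> k - rk A = fst p \<and> card A - rk A = snd p}"
      then have A: "A \<subseteq> E" "k - rk A = fst p" "card A - rk A = snd p" by auto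
      have fA: "finite A" using A finite_ground finite_subset by blast
      have "card (A - F) = 0" "card F \<le> card (A \<inter> F)" using bounds[OF A p(1,2)] F(2) p by auto
      then have "A - F = {}" "A \<inter> F = F"
        using fA fF card_seteq[OF fF, of "A \<inter> F"] by auto
      then show "A \<in> {F}" by auto
    next
      fix A assume "A \<in> {F}"
      then show "A \<in> {A. A \<subseteq> E \<and> k - rk A = fst p \<and> card A - rk A = snd p}"
        using capped_mrank[OF cap_subset] cap_subset F(2) p by auto
    qed
    then show ?thesis using False rank by (simp add: tutte_coord_def)
  qed (simp add: tutte_coord_def)
  assume q: "q \<in> tutte_indices k n" and nz: "tutte_coord M q \<noteq> 0"
  show "fst q \<le> fst p \<and> snd q \<le> snd p"
  proof (cases "q = (0, 0)")
    case False
    then have "{A. A \<subseteq> E \<and> k - rk A = fst q \<and> card A - rk A = snd q} \<noteq> {}"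
      using nz rank by (auto simp: tutte_coord_def)
    then obtain A where A: "A \<subseteq> E" "k - rk A = fst q" "card A - rk A = snd q" by blast
    have "fst q > 0" "snd q > 0" using q False by (auto simp: tutte_indices_def)
    from bounds[OF A this] show ?thesis using Int_le[of A] F(2) by auto
  qed simp
qed

section \<open>Types of the representatives and the resulting unitriangular system\<close>

theorem theoremC:
  fixes k n :: nat and Ns :: "'a matroid list" and M :: "'a matroid"
  assumes "k \<le> n"
    and reps: "\<forall>N\<in>set Ns. is_matroid N \<and> cuspidal N \<and> matroid_rank N = k \<and> card (ground N) = n"
    and distinct: "\<forall>i<length Ns. \<forall>j<length Ns. i \<noteq> j \<longrightarrow> \<not> matroid_iso (Ns ! i) (Ns ! j)"
    and complete: "\<forall>N :: 'a matroid. is_matroid N \<and> cuspidal N \<and> matroid_rank N = k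
                     \<and> card (ground N) = n \<longrightarrow> (\<exists>N'\<in>set Ns. matroid_iso N N')"
    and M: "is_matroid M" "matroid_rank M = k" "card (ground M) = n"
  shows "\<exists>!cs :: int list. length cs = length Ns
           \<and> tutte M = (\<Sum>i<length Ns. of_int (cs ! i) * tutte (Ns ! i))"
proof -
  define I where "I = {..<length Ns}"
  define Q where "Q = tutte_indices k n"
  have N: "is_matroid (Ns ! i)" "cuspidal (Ns ! i)" "matroid_rank (Ns ! i) = k"
      "card (ground (Ns ! i)) = n" if "i \<in> I" for i
    using reps that by (auto simp: I_def)
  have "\<exists>p\<in>Q. cuspidal_type k p (Ns ! i)" if "i \<in> I" for i
  proof -
    interpret finite_matroid "Ns ! i" by standard (rule N(1)[OF that])
    show ?thesis unfolding Q_def using N[OF that] by (intro cuspidal_ex_type)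
  qed
  then obtain \<pi> where \<pi>: "\<And>i. i \<in> I \<Longrightarrow> \<pi> i \<in> Q \<and> cuspidal_type k (\<pi> i) (Ns ! i)"
    by metis
  have coord_diag: "tutte_coord (Ns ! i) p = 1"
    if "i \<in> I" "p \<in> Q" "cuspidal_type k p (Ns ! i)" for i p
    using tutte_coord_cuspidal_type(1)[OF that(3)] that(2) N(4)[OF that(1)] \<open>k \<le> n\<close>
    unfolding Q_def by blast
  have coord_le: "fst q \<le> fst p \<and> snd q \<le> snd p"
    if "i \<in> I" "p \<in> Q" "cuspidal_type k p (Ns ! i)" "q \<in> Q" "tutte_coord (Ns ! i) q \<noteq> 0" for i p q
    using tutte_coord_cuspidal_type(2)[OF that(3)] that(2,4,5) N(4)[OF that(1)] \<open>k \<le> n\<close>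
    unfolding Q_def by blast
  have inj: "inj_on \<pi> I"
  proof (rule inj_onI, rule ccontr)
    fix i j assume ij: "i \<in> I" "j \<in> I" "\<pi> i = \<pi> j" "i \<noteq> j"
    \<comment> \<open>The type determines the sizes of \<open>F\<close> and of its complement as
      well as both caps, hence the isomorphism class.\<close>
    have "matroid_iso (Ns ! i) (Ns ! j)"
      using \<pi>[OF ij(1)] \<pi>[OF ij(2)] ij(3) N(4)[OF ij(1)] N(4)[OF ij(2)] unfolding cuspidal_type_def
      by (metis capped_matroids_iso)
    then show False using distinct ij by (auto simp: I_def)
  qed
  have "Q \<subseteq> \<pi> ` I"
  proof
    fix p assume p: "p \<in> Q"
    have "finite (ground M)" using M(1) by (simp add: is_matroid_def)
    \<comment> \<open>Every type is realised on the ground set of \<open>M\<close>, which supplies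
      \<open>n\<close> elements of the right HOL type.\<close>
    then obtain L :: "'a matroid" where L: "ground L = ground M" "cuspidal_type k p L"
      using ex_cuspidal_type[of "ground M" n k p] M(3) \<open>k \<le> n\<close> p unfolding Q_def by blast
    obtain F where F: "capped_matroid L F k (k - fst p)" "card F = k - fst p + snd p"
      using L(2) unfolding cuspidal_type_def by blast
    have "is_matroid L" "cuspidal L"
      using capped_matroid.capped_is_matroid[OF F(1)] capped_matroid.capped_cuspidal[OF F(1)]
      by blast+
    moreover have "matroid_rank L = k"
      using cuspidal_type_rank[OF L(2), of n] L(1) M(3) \<open>k \<le> n\<close> p unfolding Q_def by simp
    ultimately obtain N' where "N' \<in> set Ns" "matroid_iso L N'"
      using complete L(1) M(3) by auto
    then obtain i where i: "i \<in> I" "matroid_iso L (Ns ! i)"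
      by (auto simp: in_set_conv_nth I_def)
    have type: "cuspidal_type k p (Ns ! i)"
      using capped_matroid_transfer[OF F(1) i(2) N(1)[OF i(1)]] F(2)
      unfolding cuspidal_type_def by auto
    \<comment> \<open>The representative has type \<open>p\<close> as well as the chosen type
      \<open>\<pi> i\<close>. Both coordinates are nonzero, so each type bounds the other
      componentwise and the two agree.\<close>
    have "tutte_coord (Ns ! i) p \<noteq> 0" "tutte_coord (Ns ! i) (\<pi> i) \<noteq> 0"
      using coord_diag[OF i(1)] \<pi>[OF i(1)] p type by auto
    then have "p = \<pi> i"
      using coord_le[OF i(1) p type, of "\<pi> i"] coord_le[OF i(1), of "\<pi> i" p] \<pi>[OF i(1)] p
      by (auto simp: prod_eq_iff)
    then show "p \<in> \<pi> ` I" using i by blast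
  qed
  then have bij: "bij_betw \<pi> I Q" using inj \<pi> by (auto simp: bij_betw_def)
  define W where "W i j = tutte_coord (Ns ! i) (\<pi> j)" for i j
  \<comment> \<open>The sum of the components strictly decreases along the componentwise order, as
    the unitriangular lemmas require.\<close>
  define f where "f i = fst (\<pi> i) + snd (\<pi> i)" for i
  define b where "b j = tutte_basis k n (\<pi> j)" for j
  have fin: "finite I" by (simp add: I_def)
  have expand: "tutte L = (\<Sum>j\<in>I. of_int (tutte_coord L (\<pi> j)) * b j)"
    if "is_matroid L" "matroid_rank L = k" "card (ground L) = n" for L :: "'a matroid"
    using finite_matroid.tutte_expansion[OF finite_matroid.intro[OF that(1)] that(2,3)]
      sum.reindex_bij_betw[OF bij, of "\<lambda>q. of_int (tutte_coord L q) * tutte_basis k n q"]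
    by (simp add: Q_def b_def)
  have indep: "u j = 0" if "(\<Sum>j\<in>I. of_int (u j) * b j) = 0" "j \<in> I" for u j
  proof -
    define \<sigma> where "\<sigma> = the_inv_into I \<pi>"
    have \<sigma>: "\<sigma> (\<pi> j) = j" if "j \<in> I" for j
      using the_inv_into_f_f[OF inj that] by (simp add: \<sigma>_def)
    have "(\<Sum>q\<in>Q. of_int (u (\<sigma> q)) * tutte_basis k n q) = (\<Sum>j\<in>I. of_int (u j) * b j)"
      using sum.reindex_bij_betw[OF bij, of "\<lambda>q. of_int (u (\<sigma> q)) * tutte_basis k n q"]
      by (simp add: \<sigma> b_def cong: sum.cong)
    then have "u (\<sigma> (\<pi> j)) = 0"
      using tutte_basis_independent[of "\<lambda>q. u (\<sigma> q)" k n "\<pi> j"] that \<pi> by (simp add: Q_def)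
    then show ?thesis using \<sigma> that by simp
  qed
  have diag: "W i i = 1" if "i \<in> I" for i
    using coord_diag \<pi> that by (auto simp: W_def)
  have tri: "j = i \<or> f j < f i" if "i \<in> I" "j \<in> I" "W i j \<noteq> 0" for i j
  proof -
    have "fst (\<pi> j) \<le> fst (\<pi> i) \<and> snd (\<pi> j) \<le> snd (\<pi> i)"
      using coord_le[of i "\<pi> i" "\<pi> j"] \<pi> that by (auto simp: W_def)
    moreover have "\<pi> j \<noteq> \<pi> i" if "j \<noteq> i" using inj \<open>i \<in> I\<close> \<open>j \<in> I\<close> that by (auto dest: inj_onD)
    ultimately show ?thesis by (force simp: f_def prod_eq_iff)
  qed
  \<comment> \<open>Moves a combination of Tutte polynomials into the basis \<open>b\<close>, so
    that existence and uniqueness become statements about the integer matrix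
    \<open>W\<close>.\<close>
  have combination: "(\<Sum>i\<in>I. of_int (c i) * tutte (Ns ! i))
      = (\<Sum>j\<in>I. of_int (\<Sum>i\<in>I. c i * W i j) * b j)" for c :: "nat \<Rightarrow> int"
  proof -
    have "(\<Sum>i\<in>I. of_int (c i) * tutte (Ns ! i))
        = (\<Sum>i\<in>I. \<Sum>j\<in>I. of_int (c i * W i j) * b j)"
      by (rule sum.cong) (simp_all add: expand N W_def sum_distrib_left mult.assoc)
    also have "\<dots> = (\<Sum>j\<in>I. \<Sum>i\<in>I. of_int (c i * W i j) * b j)" by (rule sum.swap)
    finally show ?thesis by (simp add: sum_distrib_right)
  qed
  show ?thesis
  proof (rule ex_ex1I)
    have "\<exists>c. \<forall>j\<in>I. tutte_coord M (\<pi> j) = (\<Sum>i\<in>I. c i * W i j)"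
      by (rule unitriangular_solvable[of I W f]) (use fin diag tri in auto)
    then obtain c where "\<forall>j\<in>I. tutte_coord M (\<pi> j) = (\<Sum>i\<in>I. c i * W i j)" by blast
    then have "tutte M = (\<Sum>i\<in>I. of_int (c i) * tutte (Ns ! i))"
      unfolding combination expand[OF M] by simp
    then show "\<exists>cs :: int list. length cs = length Ns
        \<and> tutte M = (\<Sum>i<length Ns. of_int (cs ! i) * tutte (Ns ! i))"
      by (intro exI[of _ "map c [0..<length Ns]"]) (simp add: I_def)
  next
    fix cs ds :: "int list"
    assume cs: "length cs = length Ns
        \<and> tutte M = (\<Sum>i<length Ns. of_int (cs ! i) * tutte (Ns ! i))"
      and ds: "length ds = length Ns
        \<and> tutte M = (\<Sum>i<length Ns. of_int (ds ! i) * tutte (Ns ! i))"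
    define c where "c i = cs ! i - ds ! i" for i
    have "(\<Sum>i\<in>I. of_int (c i) * tutte (Ns ! i))
        = (\<Sum>i\<in>I. of_int (cs ! i) * tutte (Ns ! i)) - (\<Sum>i\<in>I. of_int (ds ! i) * tutte (Ns ! i))"
      by (simp add: c_def left_diff_distrib sum_subtractf)
    also have "\<dots> = tutte M - tutte M"
      using cs ds unfolding I_def by argo
    finally have "(\<Sum>j\<in>I. of_int (\<Sum>i\<in>I. c i * W i j) * b j) = 0"
      unfolding combination by simp
    then have zero: "(\<Sum>i\<in>I. c i * W i j) = 0" if "j \<in> I" for j
      using indep[of "\<lambda>j. \<Sum>i\<in>I. c i * W i j"] that by blast
    have "c i = 0" if "i \<in> I" for i
      by (rule unitriangular_injective[of I W f]) (use fin diag tri zero that in auto)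
    then show "cs = ds" using cs ds by (intro nth_equalityI) (auto simp: c_def I_def)
  qed
qed

end
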